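(* Let $\Gamma$ be a countable residually finite group. Then there exists a minimal Cantor system $(X,S,\mathbb{Z})$ such that $\Gamma$ is isomorphic to a subgroup of $\mathrm{Aut}(S,\mathbb{Z})$.
   Context: A Cantor set is a nonempty compact metrizable totally disconnected space without isolated points. A minimal Cantor system $(X,S,\mathbb{Z})$ is a continuous action $S$ of $\mathbb{Z}$ on a Cantor set $X$, by homeomorphisms $S^n$, $n\in\mathbb{Z}$, such that for every $x\in X$ the orbit $\{S^{n}(x):n\in\mathbb{Z}\}$ is dense in $X$. $\mathrm{Aut}(S,\mathbb{Z})$ is the group under composition of all homeomorphisms $h:X\to X$ such that $h\circ S^{n}=S^{n}\circ h$ for every $n\in\mathbb{Z}$. A group $\Gamma$ is residually finite if for all $\gamma\neq\gamma'$ in $\Gamma$ there is a homomorphism $\pi$ from $\Gamma$ to a finite group with $\pi(\gamma)\neq\pi(\gamma')$. The group $\Gamma$ is not assumed to be finitely generated. *)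

theory Defs
  imports "HOL-Analysis.Analysis" "HOL-Algebra.Group_Action" "HOL-Algebra.Elementary_Groups"
begin

text \<open>
  A quantifier over all finite groups cannot range over types. Every finite group is isomorphic to
  one whose carrier is a set of natural numbers, so the targets range over the groups on sets of
  naturals; the lemma \<open>residually_finiteI\<close> below shows that targets on an arbitrary
  type may be used instead.
\<close>

definition residually_finite :: "('g, 'm) monoid_scheme \<Rightarrow> bool"
  where "residually_finite G \<longleftrightarrow>
    (\<forall>g \<in> carrier G. \<forall>h \<in> carrier G. g \<noteq> h \<longrightarrow>
      (\<exists>F :: nat monoid. group F \<and> finite (carrier F) \<and> (\<exists>\<pi> \<in> hom G F. \<pi> g \<noteq> \<pi> h)))"

lemma finite_group_nat_copy:
  fixes F :: "('b, 'm) monoid_scheme"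
  assumes "group F" "finite (carrier F)"
  obtains F' :: "nat monoid" and f
  where "group F'" "finite (carrier F')" "f \<in> iso F F'"
proof -
  interpret group F by fact
  obtain f :: "'b \<Rightarrow> nat" where f: "inj_on f (carrier F)"
    using assms(2) finite_imp_inj_to_nat_seg by metis
  define r where "r = inv_into (carrier F) f"
  define F' where "F' = \<lparr>carrier = f ` carrier F, monoid.mult = (\<lambda>a b. f (r a \<otimes>\<^bsub>F\<^esub> r b)), one = f \<one>\<^bsub>F\<^esub>\<rparr>"
  have r: "r (f x) = x" if "x \<in> carrier F" for x
    using f that by (simp add: r_def)
  have "group F'"
  proof (rule groupI)
    fix x assume "x \<in> carrier F'"
    then obtain a where "a \<in> carrier F" "x = f a" by (auto simp: F'_def)
    then show "\<exists>y\<in>carrier F'. y \<otimes>\<^bsub>F'\<^esub> x = \<one>\<^bsub>F'\<^esub>"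
      by (auto simp: F'_def r intro!: bexI[of _ "inv\<^bsub>F\<^esub> a"])
  qed (auto simp: F'_def r m_assoc)
  moreover have "finite (carrier F')"
    using assms(2) by (simp add: F'_def)
  moreover have "f \<in> iso F F'"
    using f by (auto simp: F'_def iso_def hom_def bij_betw_def r)
  ultimately show thesis using that by blast
qed

lemma residually_finiteI:
  fixes G :: "('g, 'm) monoid_scheme"
  assumes sep: "\<And>g h. g \<in> carrier G \<Longrightarrow> h \<in> carrier G \<Longrightarrow> g \<noteq> h \<Longrightarrow>
      \<exists>F :: 'b monoid. group F \<and> finite (carrier F) \<and> (\<exists>\<pi> \<in> hom G F. \<pi> g \<noteq> \<pi> h)"
  shows "residually_finite G"
  unfolding residually_finite_def
proof (intro ballI impI)
  fix g h assume gh: "g \<in> carrier G" "h \<in> carrier G" "g \<noteq> h"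
  then obtain F :: "'b monoid" and \<pi> where F: "group F" "finite (carrier F)"
    and p: "\<pi> \<in> hom G F" "\<pi> g \<noteq> \<pi> h"
    using sep by blast
  obtain F' :: "nat monoid" and f where F': "group F'" "finite (carrier F')" and f: "f \<in> iso F F'"
    using finite_group_nat_copy[OF F] by metis
  have "f \<circ> \<pi> \<in> hom G F'"
    using p(1) f unfolding iso_def by (auto intro: hom_compose)
  moreover have "(f \<circ> \<pi>) g \<noteq> (f \<circ> \<pi>) h"
  proof -
    have "\<pi> g \<in> carrier F" "\<pi> h \<in> carrier F" using p(1) gh by (auto simp: hom_def)
    moreover have "inj_on f (carrier F)" using f by (auto simp: iso_def bij_betw_def)
    ultimately show ?thesis using p(2) by (auto dest: inj_onD)
  qed
  ultimately show "\<exists>F :: nat monoid. group F \<and> finite (carrier F) \<and> (\<exists>\<pi> \<in> hom G F. \<pi> g \<noteq> \<pi> h)"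
    using F' by blast
qed

definition cantor_space :: "'a topology \<Rightarrow> bool"
  where "cantor_space X \<longleftrightarrow>
    topspace X \<noteq> {} \<and> compact_space X \<and> metrizable_space X \<and>
    (\<forall>x \<in> topspace X. connected_component_of_set X x = {x}) \<and>
    (\<forall>x \<in> topspace X. \<not> openin X {x})"

text \<open>
  The locale \<open>group_action\<close> makes each \<open>S n\<close> an element of the library's
  \<open>BijGroup\<close>, i.e. extensional: \<open>undefined\<close> outside \<open>topspace X\<close>.
  This makes functions on the carrier set equal exactly when they agree on that set. As
  \<open>integer_group\<close> is discrete, continuity of the action is continuity of each \<open>S n\<close>.

  Every Cantor set has the cardinality of \<open>nat \<Rightarrow> nat\<close>. Hence a statement that some minimal
  Cantor system exists may take \<open>X :: (nat \<Rightarrow> nat) topology\<close> without loss of generality: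
  both \<open>topspace X\<close> and the topology on it remain arbitrary.
\<close>

definition minimal_cantor_system :: "'a topology \<Rightarrow> (int \<Rightarrow> 'a \<Rightarrow> 'a) \<Rightarrow> bool"
  where "minimal_cantor_system X S \<longleftrightarrow>
    cantor_space X \<and>
    group_action integer_group (topspace X) S \<and>
    (\<forall>n. homeomorphic_map X X (S n)) \<and>
    (\<forall>x \<in> topspace X. X closure_of (orbit integer_group S x) = topspace X)"

definition Aut_system :: "'a topology \<Rightarrow> (int \<Rightarrow> 'a \<Rightarrow> 'a) \<Rightarrow> ('a \<Rightarrow> 'a) monoid"
  where "Aut_system X S = BijGroup (topspace X)
    \<lparr>carrier := {h \<in> Bij (topspace X). homeomorphic_map X X h \<and>
                  (\<forall>n. \<forall>x \<in> topspace X. h (S n x) = S n (h x))}\<rparr>"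

lemma group_Aut_system:
  assumes S: "\<And>n. S n ` topspace X \<subseteq> topspace X"
  shows "group (Aut_system X S)"
proof -
  let ?T = "topspace X"
  let ?A = "{h \<in> Bij ?T. homeomorphic_map X X h \<and> (\<forall>n. \<forall>x \<in> ?T. h (S n x) = S n (h x))}"
  have "subgroup ?A (BijGroup ?T)"
  proof (rule subgroup.intro)
    show "?A \<subseteq> carrier (BijGroup ?T)" by (auto simp: BijGroup_def)
  next
    fix x y assume x: "x \<in> ?A" and y: "y \<in> ?A"
    have "homeomorphic_map X X (compose ?T x y)"
      using homeomorphic_map_compose[of X X y X x] x y
      by (auto elim!: homeomorphic_map_eq simp: compose_def)
    moreover have "compose ?T x y \<in> Bij ?T" using x y by (simp add: compose_Bij)
    ultimately show "x \<otimes>\<^bsub>BijGroup ?T\<^esub> y \<in> ?A"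
      using x y S Bij_imp_funcset[of y ?T]
      by (auto simp: BijGroup_def compose_def image_subset_iff Pi_iff)
  next
    have "homeomorphic_map X X (\<lambda>x\<in>?T. x)"
      using homeomorphic_map_eq[of X X id] by auto
    then show "\<one>\<^bsub>BijGroup ?T\<^esub> \<in> ?A"
      using S by (auto simp: BijGroup_def id_Bij image_subset_iff)
  next
    fix h assume h: "h \<in> ?A"
    let ?g = "\<lambda>x\<in>?T. inv_into ?T h x"
    have b: "bij_betw h ?T ?T" using h by (auto simp: Bij_def)
    obtain g where g: "homeomorphic_maps X X h g" using h by (auto simp: homeomorphic_map_maps)
    then have gh: "homeomorphic_map X X g" "\<And>x. x \<in> ?T \<Longrightarrow> h (g x) = x \<and> g (h x) = x \<and> g x \<in> ?T"
      by (auto simp: homeomorphic_maps_map dest: homeomorphic_imp_surjective_map)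
    have eq: "?g x = g x" if "x \<in> ?T" for x
      using that gh b by (metis bij_betw_inv_into_left restrict_apply')
    have "homeomorphic_map X X ?g"
      using gh(1) eq by (metis homeomorphic_map_eq)
    moreover have "?g (S n x) = S n (?g x)" if x: "x \<in> ?T" for n x
    proof -
      have "S n x \<in> ?T" "S n (g x) \<in> ?T" using S x gh(2) by blast+
      then show ?thesis
        using h gh(2) x eq by (smt (verit) mem_Collect_eq)
    qed
    ultimately show "inv\<^bsub>BijGroup ?T\<^esub> h \<in> ?A"
      using h by (simp add: inv_BijGroup restrict_inv_into_Bij del: restrict_apply)
  qed
  then show ?thesis
    unfolding Aut_system_def by (simp add: subgroup.subgroup_is_group group_BijGroup)
qed

end

theory Submission
  imports Defs
begin

text \<open>
  Replacing \<open>\<Gamma>\<close> by its product with the integers, which is again countable and residually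
  finite, it may be taken to be infinite; call the group \<open>G\<close>. Countably many homomorphisms
  \<open>\<pi> i\<close> from \<open>G\<close> to finite groups \<open>F i\<close> separate its points and embed it
  in the compact group \<open>K\<close>, the product of the \<open>F i\<close>. The phase space is a closed subset
  of the compact space of two-sided sequences over \<open>K\<close>. The integers act on it by the shift, and
  \<open>G\<close> acts by multiplying all entries of a sequence from the left by the same element. The two
  actions commute, and a group element with a fixed point is trivial, so \<open>G\<close> embeds in the
  automorphism group. What is needed is a set on which the shift is minimal and which \<open>G\<close>
  preserves.

  Such a set is the closure of all shifts of all sequences \<open>g s\<close>, where \<open>g\<close> ranges over
  \<open>G\<close> and \<open>s\<close> is one sequence of elements of \<open>G\<close>, built from nested blocks
  \<open>w\<^sub>0, w\<^sub>1, \<dots>\<close> around the origin, where \<open>w\<close> at stage \<open>n + 1\<close> is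
  the concatenation of \<open>w\<^sub>n\<close>, \<open>w\<^sub>n\<close> and \<open>gen n w\<^sub>n\<close>, with the middle
  copy at the origin. Here \<open>gen\<close> lists every element of \<open>G\<close> infinitely often. An entry
  is then a product of the \<open>gen n\<close> over those places at which the balanced ternary expansion of its
  index has the digit one. The key fact is \<open>word_recurrent\<close>: a window of \<open>s\<close> around the
  origin reappears, modulo the kernels of finitely many \<open>\<pi> i\<close>, with bounded gaps in every
  \<open>g s\<close>, and the bound on the gaps does not depend on \<open>g\<close>. Indeed, finitely many of the
  \<open>gen n\<close> represent all classes modulo these kernels, so that every sufficiently large block,
  multiplied by any group element, contains the window itself modulo these kernels.

  Because the gaps are bounded uniformly in \<open>g\<close>, the recurrence passes to the closure and gives
  minimality (\<open>shift_orbit_dense\<close>). No point is isolated, because \<open>G\<close> is infinite: any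
  finite intersection of the kernels contains a nontrivial element, which moves every point, but only to a
  nearby one (\<open>phase_space_no_isolated_points\<close>).
\<close>

section \<open>Residually finite groups\<close>

lemma residually_finiteD:
  assumes "residually_finite G" "g \<in> carrier G" "h \<in> carrier G" "g \<noteq> h"
  shows "\<exists>(F :: nat monoid) \<pi>. group F \<and> finite (carrier F) \<and> \<pi> \<in> hom G F \<and> \<pi> g \<noteq> \<pi> h"
  using assms unfolding residually_finite_def by blast

lemma residually_finite_DirProd:
  assumes "residually_finite G" "residually_finite H"
  shows "residually_finite (G \<times>\<times> H)"
proof (rule residually_finiteI)
  fix x y assume xy: "x \<in> carrier (G \<times>\<times> H)" "y \<in> carrier (G \<times>\<times> H)" "x \<noteq> y"
  show "\<exists>F :: nat monoid. group F \<and> finite (carrier F) \<and> (\<exists>\<pi> \<in> hom (G \<times>\<times> H) F. \<pi> x \<noteq> \<pi> y)"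
  proof (cases "fst x = fst y")
    case False
    then obtain F :: "nat monoid" and \<pi>
      where F: "group F" "finite (carrier F)" "\<pi> \<in> hom G F" "\<pi> (fst x) \<noteq> \<pi> (fst y)"
      using residually_finiteD[OF assms(1), of "fst x" "fst y"] xy by (auto simp: mem_Times_iff)
    then have "\<pi> \<circ> fst \<in> hom (G \<times>\<times> H) F"
      by (auto simp: hom_def mult_DirProd')
    with F show ?thesis by (metis comp_apply)
  next
    case True
    then have "snd x \<noteq> snd y" using xy(3) by (simp add: prod_eq_iff)
    then obtain F :: "nat monoid" and \<pi>
      where F: "group F" "finite (carrier F)" "\<pi> \<in> hom H F" "\<pi> (snd x) \<noteq> \<pi> (snd y)"
      using residually_finiteD[OF assms(2), of "snd x" "snd y"] xy by (auto simp: mem_Times_iff)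
    then have "\<pi> \<circ> snd \<in> hom (G \<times>\<times> H) F"
      by (auto simp: hom_def mult_DirProd')
    with F show ?thesis by (metis comp_apply)
  qed
qed

lemma residually_finite_integer_group: "residually_finite integer_group"
proof (rule residually_finiteI)
  fix g h :: int assume "g \<noteq> h"
  define n where "n = Suc (nat \<bar>g - h\<bar>)"
  have "n > 0" by (simp add: n_def)
  then have "(\<lambda>k. k mod int n) \<in> hom integer_group (integer_mod_group n)"
    by (intro homI) (simp_all add: carrier_integer_mod_group mod_add_eq)
  moreover have "g mod int n \<noteq> h mod int n"
  proof
    assume "g mod int n = h mod int n"
    then have "int n dvd g - h" by (simp add: mod_eq_dvd_iff)
    then have "int n \<le> \<bar>g - h\<bar>"
      using \<open>g \<noteq> h\<close> by (intro zdvd_imp_le) auto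
    then show False by (simp add: n_def)
  qed
  moreover have "finite (carrier (integer_mod_group n))"
    using \<open>n > 0\<close> by (simp add: carrier_integer_mod_group)
  ultimately show "\<exists>F :: int monoid. group F \<and> finite (carrier F) \<and> (\<exists>\<pi>\<in>hom integer_group F. \<pi> g \<noteq> \<pi> h)"
    by (intro exI[of _ "integer_mod_group n"] conjI group_integer_mod_group bexI[of _ "\<lambda>k. k mod int n"])
qed

text \<open>
  Countability is what allows the separating homomorphisms to be arranged in a sequence, one for each pair
  of distinct elements; this makes the sequence space over their targets metrizable.
\<close>

lemma separating_sequence:
  assumes "countable (carrier G)" "infinite (carrier G)" "residually_finite G"
  obtains F :: "nat \<Rightarrow> nat monoid" and \<pi>
  where "\<And>i. group (F i)" "\<And>i. finite (carrier (F i))" "\<And>i. \<pi> i \<in> hom G (F i)"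
    "\<And>g h. g \<in> carrier G \<Longrightarrow> h \<in> carrier G \<Longrightarrow> (\<And>i. \<pi> i g = \<pi> i h) \<Longrightarrow> g = h"
proof -
  define D where "D = {p \<in> carrier G \<times> carrier G. fst p \<noteq> snd p}"
  have "countable D" using assms(1) unfolding D_def by auto
  (* from_nat_into enumerates only a nonempty set, so two distinct elements are needed. *)
  obtain a where a: "a \<in> carrier G" using assms(2) by fastforce
  have "infinite (carrier G - {a})" using assms(2) by simp
  then obtain b where "b \<in> carrier G - {a}" by (metis all_not_in_conv finite.emptyI)
  with a have "(a, b) \<in> D" by (auto simp: D_def)
  then have "D \<noteq> {}" by blast
  define p where "p = from_nat_into D"
  have range_p: "range p = D"
    using \<open>countable D\<close> \<open>D \<noteq> {}\<close> by (simp add: p_def)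
  have "\<exists>F :: nat monoid. \<exists>\<pi>. group F \<and> finite (carrier F) \<and> \<pi> \<in> hom G F \<and> \<pi> (fst (p i)) \<noteq> \<pi> (snd (p i))" for i
  proof -
    have "p i \<in> D" using range_p by blast
    then show ?thesis
      using residually_finiteD[OF assms(3), of "fst (p i)" "snd (p i)"]
      by (simp add: D_def mem_Times_iff)
  qed
  then obtain F :: "nat \<Rightarrow> nat monoid" and \<pi> where F: "\<And>i. group (F i)" "\<And>i. finite (carrier (F i))"
    "\<And>i. \<pi> i \<in> hom G (F i)" "\<And>i. \<pi> i (fst (p i)) \<noteq> \<pi> i (snd (p i))"
    by metis
  have "g = h" if "g \<in> carrier G" "h \<in> carrier G" "\<And>i. \<pi> i g = \<pi> i h" for g h
  proof (rule ccontr)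
    assume "g \<noteq> h"
    then have "(g, h) \<in> range p" using that range_p by (simp add: D_def)
    then obtain i where "p i = (g, h)" by (metis imageE)
    with F(4)[of i] that(3)[of i] show False by simp
  qed
  with F that show thesis by blast
qed

lemma infinitely_recurring_enumeration:
  assumes "countable A" "A \<noteq> {}"
  shows "\<exists>e :: nat \<Rightarrow> 'a. (\<forall>i. e i \<in> A) \<and> (\<forall>a\<in>A. \<forall>m. \<exists>i\<ge>m. e i = a)"
proof -
  define e where "e i = from_nat_into A (fst (prod_decode i))" for i
  have "\<exists>i\<ge>m. e i = a" if a: "a \<in> A" for a m
  proof -
    obtain j where "from_nat_into A j = a"
      using from_nat_into_surj[OF assms(1) a] by blast
    then have "e (prod_encode (j, m)) = a" by (simp add: e_def)
    then show ?thesis by (metis le_prod_encode_2)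
  qed
  moreover have "e i \<in> A" for i using assms(2) by (simp add: e_def from_nat_into)
  ultimately show ?thesis by blast
qed

section \<open>Arrays of naturals as points of the Baire space\<close>

text \<open>
  A point of the phase space is an array of naturals with rows indexed by positions in \<open>int\<close> and
  columns by \<open>nat\<close>. It is stored as a function on \<open>nat\<close> by means of a bijection between
  the index sets.
\<close>

definition cell :: "int \<Rightarrow> nat \<Rightarrow> nat"
  where "cell k i = prod_encode (int_encode k, i)"

definition array :: "(int \<Rightarrow> nat \<Rightarrow> 'b) \<Rightarrow> nat \<Rightarrow> 'b"
  where "array f j = f (int_decode (fst (prod_decode j))) (snd (prod_decode j))"

lemma array_cell [simp]: "array f (cell k i) = f k i"
  by (simp add: array_def cell_def)

lemma cell_cases: obtains k i where "j = cell k i"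
proof
  show "j = cell (int_decode (fst (prod_decode j))) (snd (prod_decode j))"
    by (simp add: cell_def)
qed

lemma array_eqI: "(\<And>k i. y (cell k i) = z (cell k i)) \<Longrightarrow> y = z"
  by (metis cell_cases ext)

lemma continuous_on_coordinate: "continuous_on A (\<lambda>y. y j)"
  by (rule continuous_on_subset[OF continuous_on_product_coordinates subset_UNIV])

lemma continuous_on_array:
  assumes "\<And>k i. continuous_on A (\<lambda>y. f y k i)"
  shows "continuous_on A (\<lambda>y. array (f y))"
  unfolding array_def by (intro continuous_on_coordinatewise_then_product assms)

text \<open>
  The sets of arrays that agree with a given one on a finite window form a neighbourhood basis, so closures
  and isolated points can be treated combinatorially.
\<close>

definition agree :: "nat \<Rightarrow> (nat \<Rightarrow> nat) \<Rightarrow> (nat \<Rightarrow> nat) \<Rightarrow> bool"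
  where "agree N y z \<longleftrightarrow> (\<forall>k i. \<bar>k\<bar> \<le> int N \<longrightarrow> i < N \<longrightarrow> y (cell k i) = z (cell k i))"

lemma open_agree: "open {y. agree N y z}"
proof -
  have "{y. agree N y z} =
    {y. \<forall>p \<in> {-int N..int N} \<times> {..<N}. y (cell (fst p) (snd p)) \<in> {z (cell (fst p) (snd p))}}"
    by (auto simp: agree_def abs_le_iff)
  also have "open \<dots>"
    by (rule product_topology_basis') (auto simp: open_discrete)
  finally show ?thesis .
qed

lemma agree_neighbourhood:
  assumes "open U" "z \<in> U"
  obtains N where "\<And>y. agree N y z \<Longrightarrow> y \<in> U"
proof -
  have "openin (product_topology (\<lambda>i::nat. euclidean :: nat topology) UNIV) U"
    using assms(1) by (simp add: open_fun_def)
  from product_topology_open_contains_basis[OF this assms(2)]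
  obtain B where B: "z \<in> (\<Pi>\<^sub>E i\<in>UNIV. B i)" "finite {i. B i \<noteq> UNIV}" "(\<Pi>\<^sub>E i\<in>UNIV. B i) \<subseteq> U"
    by auto
  (* A window of size w j contains the coordinate j. *)
  define J where "J = {i. B i \<noteq> UNIV}"
  define w where "w j = nat \<bar>int_decode (fst (prod_decode j))\<bar> + Suc (snd (prod_decode j))" for j
  define N where "N = Max (insert 0 (w ` J))"
  have "y \<in> U" if y: "agree N y z" for y
  proof -
    have "y j \<in> B j" for j
    proof (cases "j \<in> J")
      case True
      obtain k i where j: "j = cell k i" by (rule cell_cases)
      have "w j \<le> N" using True B(2) by (simp add: N_def J_def)
      then have "y j = z j" using y unfolding agree_def j by (simp add: w_def cell_def)
      then show ?thesis using B(1) by auto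
    qed (auto simp: J_def)
    then show ?thesis using B(3) by auto
  qed
  then show thesis by (rule that)
qed

lemma closure_agree: "z \<in> closure Q \<longleftrightarrow> (\<forall>N. \<exists>q\<in>Q. agree N q z)"
proof
  assume z: "z \<in> closure Q"
  show "\<forall>N. \<exists>q\<in>Q. agree N q z"
  proof
    fix N
    have "z \<in> {y. agree N y z}" by (simp add: agree_def)
    then show "\<exists>q\<in>Q. agree N q z"
      using z open_agree[of N z] unfolding closure_iff_nhds_not_empty by blast
  qed
next
  assume *: "\<forall>N. \<exists>q\<in>Q. agree N q z"
  show "z \<in> closure Q"
    unfolding closure_iff_nhds_not_empty
  proof (intro allI impI)
    fix A U assume "U \<subseteq> A" "open U" "z \<in> U"
    then show "Q \<inter> A \<noteq> {}" by (metis "*" agree_neighbourhood disjoint_iff subsetD)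
  qed
qed

lemma compact_finite_arrays:
  assumes "\<And>i. finite (C i)"
  shows "compact {y. \<forall>k i. y (cell k i) \<in> (C i :: nat set)}"
proof -
  have "compactin (product_topology (\<lambda>j::nat. euclidean) UNIV) (PiE UNIV (array (\<lambda>k i. C i)))"
    unfolding compactin_PiE using assms by (auto simp: array_def finite_imp_compact)
  moreover have "PiE UNIV (array (\<lambda>k i. C i)) = {y. \<forall>k i. y (cell k i) \<in> C i}"
  proof -
    have "(\<forall>j. y j \<in> array (\<lambda>k. C) j) \<longleftrightarrow> (\<forall>k i. y (cell k i) \<in> C i)" for y
      by (metis array_cell cell_cases)
    then show ?thesis by (auto simp: PiE_iff)
  qed
  ultimately show ?thesis by (simp add: euclidean_product_topology)
qed

lemma metrizable_space_fun_discrete: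
  "metrizable_space (euclidean :: ('a::countable \<Rightarrow> 'b::discrete_topology) topology)"
proof -
  have "(euclidean :: 'b topology) = discrete_topology UNIV"
    by (simp add: topology_eq open_discrete)
  then have "metrizable_space (product_topology (\<lambda>_::'a. euclidean :: 'b topology) UNIV)"
    by (simp add: metrizable_space_product_topology)
  then show ?thesis by (simp add: euclidean_product_topology)
qed

lemma connected_fun_discrete_imp_singleton:
  fixes C :: "('a \<Rightarrow> 'b::discrete_topology) set"
  assumes "connected C" "y \<in> C"
  shows "C = {y}"
proof -
  have "z = y" if "z \<in> C" for z
  proof
    fix j
    have "continuous_on C (\<lambda>x. x j = y j)"
      by (rule continuous_on_compose2[of UNIV "\<lambda>v. v = y j"])
        (auto intro: continuous_on_coordinate)
    then have "\<exists>c. \<forall>x\<in>C. (x j = y j) = c"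
      using assms(1) by (simp add: connected_iff_const)
    then show "z j = y j" using assms(2) that by auto
  qed
  then show ?thesis using assms by blast
qed

definition shift :: "int \<Rightarrow> (nat \<Rightarrow> nat) \<Rightarrow> nat \<Rightarrow> nat"
  where "shift r y = array (\<lambda>k i. y (cell (k + r) i))"

lemma shift_cell [simp]: "shift r y (cell k i) = y (cell (k + r) i)"
  by (simp add: shift_def)

lemma continuous_on_shift: "continuous_on A (shift r)"
  unfolding shift_def
  by (intro continuous_on_array continuous_on_coordinate)

section \<open>Group actions by homeomorphisms\<close>

lemma restrict_action_hom_BijGroup:
  assumes "group G"
    and closed: "\<And>g x. g \<in> carrier G \<Longrightarrow> x \<in> E \<Longrightarrow> f g x \<in> E"
    and one: "\<And>x. x \<in> E \<Longrightarrow> f \<one>\<^bsub>G\<^esub> x = x"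
    and mult: "\<And>g h x. g \<in> carrier G \<Longrightarrow> h \<in> carrier G \<Longrightarrow> x \<in> E \<Longrightarrow> f (g \<otimes>\<^bsub>G\<^esub> h) x = f g (f h x)"
  shows "(\<lambda>g. restrict (f g) E) \<in> hom G (BijGroup E)"
proof -
  interpret group G by fact
  have bij: "restrict (f g) E \<in> Bij E" if g: "g \<in> carrier G" for g
  proof -
    have "bij_betw (f g) E E"
      by (rule bij_betw_byWitness[where f' = "f (inv\<^bsub>G\<^esub> g)"])
        (use g closed in \<open>auto simp flip: mult simp: one\<close>)
    then show ?thesis by (simp add: Bij_def)
  qed
  show ?thesis
    by (rule homI) (auto simp: BijGroup_def bij compose_def mult closed fun_eq_iff)
qed

lemma restrict_action_homeomorphic_map:
  assumes "group G"
    and closed: "\<And>g x. g \<in> carrier G \<Longrightarrow> x \<in> E \<Longrightarrow> f g x \<in> E"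
    and one: "\<And>x. x \<in> E \<Longrightarrow> f \<one>\<^bsub>G\<^esub> x = x"
    and mult: "\<And>g h x. g \<in> carrier G \<Longrightarrow> h \<in> carrier G \<Longrightarrow> x \<in> E \<Longrightarrow> f (g \<otimes>\<^bsub>G\<^esub> h) x = f g (f h x)"
    and cont: "\<And>g. g \<in> carrier G \<Longrightarrow> continuous_on E (f g)"
    and g: "g \<in> carrier G"
  shows "homeomorphic_map (top_of_set E) (top_of_set E) (restrict (f g) E)"
proof -
  interpret group G by fact
  have "homeomorphic_maps (top_of_set E) (top_of_set E) (f g) (f (inv\<^bsub>G\<^esub> g))"
    unfolding homeomorphic_maps_def using g closed cont
    by (auto simp: continuous_map_in_subtopology one simp flip: mult)
  then have "homeomorphic_map (top_of_set E) (top_of_set E) (f g)"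
    by (auto simp: homeomorphic_map_maps)
  then show ?thesis by (rule homeomorphic_map_eq) auto
qed

section \<open>The recurrent sequence\<close>

text \<open>
  The homomorphisms \<open>\<pi> i\<close> are the coordinates of an embedding of \<open>G\<close> in a product of
  finite groups. That \<open>gen\<close> takes every value infinitely often ensures that all classes modulo
  finitely many kernels are still represented after any given stage.
\<close>

locale separated_group = group G for G (structure) +
  fixes F :: "nat \<Rightarrow> nat monoid" and \<pi> :: "nat \<Rightarrow> 'a \<Rightarrow> nat" and gen :: "nat \<Rightarrow> 'a"
  assumes group_F: "group (F i)"
    and finite_F: "finite (carrier (F i))"
    and hom_\<pi>: "\<pi> i \<in> hom G (F i)"
    and separated: "g \<in> carrier G \<Longrightarrow> h \<in> carrier G \<Longrightarrow> (\<And>i. \<pi> i g = \<pi> i h) \<Longrightarrow> g = h"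
    and infinite_carrier: "infinite (carrier G)"
    and gen_closed [simp]: "gen i \<in> carrier G"
    and gen_recurs: "g \<in> carrier G \<Longrightarrow> \<exists>i\<ge>m. gen i = g"
begin

lemma \<pi>_closed: "g \<in> carrier G \<Longrightarrow> \<pi> i g \<in> carrier (F i)"
  using hom_\<pi>[of i] by (auto simp: hom_def)

lemma \<pi>_mult: "g \<in> carrier G \<Longrightarrow> h \<in> carrier G \<Longrightarrow> \<pi> i (g \<otimes> h) = \<pi> i g \<otimes>\<^bsub>F i\<^esub> \<pi> i h"
  using hom_\<pi>[of i] by (auto simp: hom_def)

lemma \<pi>_one: "\<pi> i \<one> = \<one>\<^bsub>F i\<^esub>"
  using hom_one[OF hom_\<pi> is_group group_F] .

definition residue :: "nat \<Rightarrow> 'a \<Rightarrow> nat \<Rightarrow> nat"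
  where "residue n g = restrict (\<lambda>i. \<pi> i g) {..<n}"

lemma residue_eq_iff: "residue n g = residue n h \<longleftrightarrow> (\<forall>i<n. \<pi> i g = \<pi> i h)"
  by (auto simp: residue_def restrict_def fun_eq_iff)

lemma finite_residues: "finite (residue n ` carrier G)"
proof (rule finite_subset)
  show "residue n ` carrier G \<subseteq> (\<Pi>\<^sub>E i\<in>{..<n}. carrier (F i))"
    unfolding residue_def image_subset_iff restrict_PiE_iff by (simp add: \<pi>_closed)
  show "finite (\<Pi>\<^sub>E i\<in>{..<n}. carrier (F i))"
    by (intro finite_PiE) (auto simp: finite_F)
qed

text \<open>
  An infinite group cannot inject into a finite product of finite groups.
\<close>

lemma nontrivial_kernel_element:
  obtains g where "g \<in> carrier G" "g \<noteq> \<one>" "\<And>i. i < n \<Longrightarrow> \<pi> i g = \<one>\<^bsub>F i\<^esub>"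
proof -
  have "\<not> inj_on (residue n) (carrier G)"
    using finite_residues infinite_carrier finite_imageD by blast
  then obtain a b where ab: "a \<in> carrier G" "b \<in> carrier G" "a \<noteq> b"
    "residue n a = residue n b"
    by (auto simp: inj_on_def)
  have "\<pi> i (inv a \<otimes> b) = \<one>\<^bsub>F i\<^esub>" if "i < n" for i
  proof -
    have "\<pi> i a = \<pi> i b" using ab(4) that by (simp add: residue_eq_iff)
    then have "\<pi> i (inv a \<otimes> b) = \<pi> i (inv a \<otimes> a)" using ab(1,2) by (simp only: \<pi>_mult inv_closed)
    then show ?thesis using ab(1) by (simp add: \<pi>_one)
  qed
  moreover have "inv a \<otimes> b \<noteq> \<one>" using ab by (metis inv_closed inv_equality inv_inv)
  ultimately show thesis using that ab by blast
qed

text \<open>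
  There are finitely many residues, and each is represented by some \<open>gen j\<close> with \<open>j\<close> as large
  as desired.
\<close>

lemma gen_covers_residues:
  obtains M where "m < M"
    "\<And>g. g \<in> carrier G \<Longrightarrow> \<exists>j. m \<le> j \<and> j < M \<and> (\<forall>i<n. \<pi> i (gen j) = \<pi> i g)"
proof -
  obtain R where R: "R \<subseteq> carrier G" "finite R"
    "residue n ` carrier G = residue n ` R"
    using finite_subset_image[OF finite_residues[of n] order_refl] by metis
  have "\<forall>g\<in>R. \<exists>j. m \<le> j \<and> gen j = g" using gen_recurs R(1) by blast
  then obtain p where p: "\<And>g. g \<in> R \<Longrightarrow> m \<le> p g \<and> gen (p g) = g"
    by (auto dest!: bchoice)
  define M where "M = Suc (Max (insert m (p ` R)))"
  have "\<exists>j. m \<le> j \<and> j < M \<and> (\<forall>i<n. \<pi> i (gen j) = \<pi> i g)" if "g \<in> carrier G" for g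
  proof -
    have "residue n g \<in> residue n ` R"
      using that R(3) by blast
    then obtain h where h: "h \<in> R" "\<And>i. i < n \<Longrightarrow> \<pi> i h = \<pi> i g"
      by (auto simp: residue_eq_iff)
    moreover have "p h < M" using h(1) R(2) by (simp add: M_def less_Suc_eq_le)
    ultimately show ?thesis using p[OF h(1)] by auto
  qed
  moreover have "m < M" using R(2) by (simp add: M_def less_Suc_eq_le)
  ultimately show thesis using that by blast
qed

text \<open>
  \<open>word 0\<close> is the recurrent sequence; \<open>word n\<close> is built in the same way from the generators
  from index \<open>n\<close> on. The recursion strips the lowest balanced ternary digit: with
  \<open>q = (k + 1) div 3\<close>, the digit \<open>k - 3 q\<close> is \<open>-1\<close>, \<open>0\<close> or
  \<open>1\<close>. Unlike ordinary ternary expansions, balanced ones are finite for negative integers too, and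
  the blocks \<open>2 \<bar>k\<bar> < 3 ^ m\<close> of indices with at most \<open>m\<close> digits are centred at the
  origin, so that every finite window around the origin lies in a single block.
\<close>

function word :: "nat \<Rightarrow> int \<Rightarrow> 'a"
  where "word n k = (if k = 0 then \<one>
    else word (Suc n) ((k + 1) div 3) \<otimes> (if k mod 3 = 1 then gen n else \<one>))"
  by auto
termination
proof (relation "Wellfounded.measure (\<lambda>(n, k). nat \<bar>k\<bar>)")
  fix n :: nat and k :: int assume "k \<noteq> 0"
  then have "\<bar>(k + 1) div 3\<bar> < \<bar>k\<bar>" by presburger
  then show "((Suc n, (k + 1) div 3), n, k) \<in> Wellfounded.measure (\<lambda>(n, k). nat \<bar>k\<bar>)"
    by simp
qed (rule wf_measure)

declare word.simps [simp del]

lemma word_zero [simp]: "word n 0 = \<one>"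
  by (simp add: word.simps)

lemma word_closed [simp]: "word n k \<in> carrier G"
proof (induction n k rule: word.induct)
  case (1 n k)
  then show ?case by (subst word.simps) simp
qed

lemma word_digit:
  "word n k = word (Suc n) ((k + 1) div 3) \<otimes> (if k mod 3 = 1 then gen n else \<one>)"
proof (cases "k = 0")
  case False
  then show ?thesis by (subst word.simps) simp
qed simp

text \<open>
  The expansion of \<open>k + 3 ^ m * j\<close> is that of \<open>k\<close>, padded to \<open>m\<close> digits, followed by
  that of \<open>j\<close>. Since higher digits multiply on the left, the whole block around
  \<open>3 ^ m * j\<close> is the central block multiplied on the left by one group element.
\<close>

lemma word_block:
  assumes "2 * \<bar>k\<bar> < 3 ^ m"
  shows "word n (k + 3 ^ m * j) = word (n + m) j \<otimes> word n k"
  using assms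
proof (induction m arbitrary: n k)
  case 0
  then have "k = 0" by simp
  then show ?case by simp
next
  case (Suc m)
  define A :: int where "A = 3 ^ m"
  define q where "q = (k + 1) div 3"
  have odd: "odd A" by (simp add: A_def)
  have k: "2 * \<bar>k\<bar> < 3 * A" using Suc.prems by (simp add: A_def)
  have q: "2 * \<bar>q\<bar> < 3 ^ m"
  proof -
    (* The bound on k gives only a weak inequality; it is strict because a power of three is odd. *)
    have "3 * q \<le> k + 1" "k + 1 \<le> 3 * q + 2" unfolding q_def by linarith+
    then have "2 * \<bar>q\<bar> \<le> A" using k by linarith
    moreover have "2 * \<bar>q\<bar> \<noteq> A" using odd by auto
    ultimately show ?thesis by (simp add: A_def)
  qed
  have "k + 3 ^ Suc m * j = k + 3 * (3 ^ m * j)" by simp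
  then have "(k + 3 ^ Suc m * j + 1) div 3 = q + 3 ^ m * j" "(k + 3 ^ Suc m * j) mod 3 = k mod 3"
    unfolding q_def by presburger+
  then have "word n (k + 3 ^ Suc m * j) =
    word (Suc n) (q + 3 ^ m * j) \<otimes> (if k mod 3 = 1 then gen n else \<one>)"
    by (subst word_digit) simp
  also have "\<dots> = word (n + Suc m) j \<otimes> (word (Suc n) q \<otimes> (if k mod 3 = 1 then gen n else \<one>))"
    using Suc.IH[OF q, of "Suc n"] by (simp add: m_assoc)
  also have "word (Suc n) q \<otimes> (if k mod 3 = 1 then gen n else \<one>) = word n k"
    by (simp add: word_digit[of n k] q_def)
  finally show ?case .
qed

lemma word_one: "word n 1 = gen n"
  by (subst word_digit) simp

text \<open>
  Moving by \<open>3 ^ M * r + 3 ^ i\<close> puts the digits of \<open>r\<close> at the places from \<open>M\<close> on and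
  a digit one at the place \<open>i\<close>. For fixed \<open>r\<close>, the choice of \<open>i\<close> between \<open>m\<close>
  and \<open>M\<close> decides which generator enters the factor of the window.
\<close>

lemma word_insert_digit:
  assumes "2 * \<bar>k\<bar> < 3 ^ m" "m \<le> i" "i < M"
  shows "word 0 (k + (3 ^ M * r + 3 ^ i)) = word M r \<otimes> gen i \<otimes> word 0 k"
proof -
  define J :: int where "J = 1 + 3 ^ (M - i) * r"
  have "3 ^ M = (3 ^ m * (3 ^ (i - m) * 3 ^ (M - i)) :: int)" "3 ^ i = (3 ^ m * 3 ^ (i - m) :: int)"
    using assms(2,3) by (simp_all flip: power_add)
  then have "3 ^ M * r + 3 ^ i = 3 ^ m * (3 ^ (i - m) * J)"
    by (simp add: J_def algebra_simps)
  then have "word 0 (k + (3 ^ M * r + 3 ^ i)) = word m (3 ^ (i - m) * J) \<otimes> word 0 k"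
    using word_block[OF assms(1), of 0] by simp
  also have "word m (3 ^ (i - m) * J) = word i J"
    using word_block[of 0 "i - m" m J] assms(2) by simp
  also have "word i J = word M r \<otimes> gen i"
  proof -
    have "(3::int) ^ 1 \<le> 3 ^ (M - i)" using assms(3) by (intro power_increasing) auto
    then show ?thesis
      unfolding J_def using word_block[of 1 "M - i" i r] assms(3) by (simp add: word_one)
  qed
  finally show ?thesis .
qed

text \<open>
  To return within bounded time after \<open>p\<close>, first move to the next multiple \<open>3 ^ M * r\<close> of
  \<open>3 ^ M\<close>; there the window is multiplied by the uncontrolled factor \<open>g \<otimes> word M r\<close>. A further
  move by \<open>3 ^ j\<close> inserts \<open>gen j\<close>, chosen to cancel that factor modulo the kernels of the
  first \<open>n\<close> homomorphisms. The number \<open>M\<close> depends only on \<open>N\<close> and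
  \<open>n\<close>.
\<close>

lemma word_recurrent:
  obtains L :: int where "0 \<le> L"
    "\<And>g p. g \<in> carrier G \<Longrightarrow> \<exists>t. p \<le> t \<and> t \<le> p + L \<and>
      (\<forall>k i. \<bar>k\<bar> \<le> int N \<longrightarrow> i < n \<longrightarrow> \<pi> i (g \<otimes> word 0 (k + t)) = \<pi> i (word 0 k))"
proof -
  (* Any m with 2 * N < 3 ^ m will do. *)
  define m where "m = 2 * N + 1"
  have "2 * N < 3 ^ m"
    using less_exp[of m] power_mono[of 2 "3::nat" m] by (simp add: m_def)
  then have window: "2 * \<bar>k\<bar> < 3 ^ m" if "\<bar>k\<bar> \<le> int N" for k
    using that by (metis (mono_tags, lifting) mult_left_mono of_nat_less_iff of_nat_mult
        of_nat_numeral of_nat_power order_le_less_trans zero_le_numeral)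
  obtain M where M: "m < M"
    "\<And>g. g \<in> carrier G \<Longrightarrow> \<exists>j. m \<le> j \<and> j < M \<and> (\<forall>i<n. \<pi> i (gen j) = \<pi> i g)"
    using gen_covers_residues by blast
  show thesis
  proof (rule that[of "2 * 3 ^ M"])
    fix g and p :: int assume g: "g \<in> carrier G"
    define r where "r = p div 3 ^ M + 1"
    have r: "p \<le> 3 ^ M * r" "3 ^ M * r \<le> p + 3 ^ M"
    proof -
      have "3 ^ M * (p div 3 ^ M) + p mod 3 ^ M = p" "0 \<le> p mod 3 ^ M" "p mod 3 ^ M < 3 ^ M"
        by simp_all
      then show "p \<le> 3 ^ M * r" "3 ^ M * r \<le> p + 3 ^ M"
        unfolding r_def distrib_left by linarith+
    qed
    obtain j where j: "m \<le> j" "j < M" "\<And>i. i < n \<Longrightarrow> \<pi> i (gen j) = \<pi> i (inv (g \<otimes> word M r))"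
      using M(2)[of "inv (g \<otimes> word M r)"] g by auto
    define t where "t = 3 ^ M * r + 3 ^ j"
    have "(3::int) ^ j \<le> 3 ^ M" "(0::int) \<le> 3 ^ j" using j(2) by (simp_all add: power_increasing)
    then have "p \<le> t" "t \<le> p + 2 * 3 ^ M" using r unfolding t_def by linarith+
    moreover have "\<pi> i (g \<otimes> word 0 (k + t)) = \<pi> i (word 0 k)" if "\<bar>k\<bar> \<le> int N" "i < n" for k i
    proof -
      have "g \<otimes> word 0 (k + t) = (g \<otimes> word M r) \<otimes> gen j \<otimes> word 0 k"
        unfolding t_def word_insert_digit[OF window[OF that(1)] j(1,2)] using g by (simp add: m_assoc)
      then have "\<pi> i (g \<otimes> word 0 (k + t)) = \<pi> i ((g \<otimes> word M r) \<otimes> inv (g \<otimes> word M r) \<otimes> word 0 k)"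
        using g j(3)[OF that(2)] by (simp only: \<pi>_mult m_closed inv_closed word_closed gen_closed)
      also have "(g \<otimes> word M r) \<otimes> inv (g \<otimes> word M r) \<otimes> word 0 k = word 0 k"
        using g by simp
      finally show ?thesis .
    qed
    ultimately show "\<exists>t. p \<le> t \<and> t \<le> p + 2 * 3 ^ M \<and>
      (\<forall>k i. \<bar>k\<bar> \<le> int N \<longrightarrow> i < n \<longrightarrow> \<pi> i (g \<otimes> word 0 (k + t)) = \<pi> i (word 0 k))"
      by blast
  qed simp
qed

section \<open>The minimal Cantor system\<close>

definition point :: "int \<Rightarrow> 'a \<Rightarrow> nat \<Rightarrow> nat"
  where "point t g = array (\<lambda>k i. \<pi> i (g \<otimes> word 0 (k + t)))"

definition phase_space :: "(nat \<Rightarrow> nat) set"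
  where "phase_space = closure {point t g | t g. g \<in> carrier G}"

text \<open>
  Left multiplication by \<open>g\<close>, carried over to arrays: it sends \<open>point t h\<close> to
  \<open>point t (g \<otimes> h)\<close>.
\<close>

definition act :: "'a \<Rightarrow> (nat \<Rightarrow> nat) \<Rightarrow> nat \<Rightarrow> nat"
  where "act g y = array (\<lambda>k i. \<pi> i g \<otimes>\<^bsub>F i\<^esub> y (cell k i))"

lemma point_cell [simp]: "point t g (cell k i) = \<pi> i (g \<otimes> word 0 (k + t))"
  by (simp add: point_def)

lemma act_cell [simp]: "act g y (cell k i) = \<pi> i g \<otimes>\<^bsub>F i\<^esub> y (cell k i)"
  by (simp add: act_def)

lemma point_in_phase_space: "g \<in> carrier G \<Longrightarrow> point t g \<in> phase_space"
  unfolding phase_space_def by (intro closure_subset[THEN subsetD]) blast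

lemma phase_space_approx:
  assumes "y \<in> phase_space"
  obtains t g where "g \<in> carrier G" "agree N (point t g) y"
  using assms unfolding phase_space_def closure_agree by blast

lemma phase_space_cell:
  assumes "y \<in> phase_space"
  shows "y (cell k i) \<in> carrier (F i)"
proof -
  obtain t g where "g \<in> carrier G" "agree (nat \<bar>k\<bar> + Suc i) (point t g) y"
    using phase_space_approx[OF assms] .
  then have "y (cell k i) = \<pi> i (g \<otimes> word 0 (k + t))" "g \<otimes> word 0 (k + t) \<in> carrier G"
    by (simp_all add: agree_def)
  then show ?thesis by (simp only: \<pi>_closed)
qed

lemma compact_phase_space: "compact phase_space"
proof -
  have "phase_space = {y. \<forall>k i. y (cell k i) \<in> carrier (F i)} \<inter> phase_space"
    using phase_space_cell by blast
  moreover have "compact ({y. \<forall>k i. y (cell k i) \<in> carrier (F i)} \<inter> phase_space)"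
    by (intro compact_Int_closed compact_finite_arrays finite_F) (simp add: phase_space_def)
  ultimately show ?thesis by simp
qed

lemma phase_space_invariant:
  assumes "continuous_on phase_space f"
    and "\<And>t g. g \<in> carrier G \<Longrightarrow> f (point t g) \<in> phase_space"
    and "y \<in> phase_space"
  shows "f y \<in> phase_space"
proof -
  have "f ` closure {point t g | t g. g \<in> carrier G} \<subseteq> phase_space"
    by (rule image_closure_subset) (use assms(1,2) in \<open>auto simp: phase_space_def\<close>)
  then show ?thesis using assms(3) by (auto simp: phase_space_def)
qed

lemma shift_phase_space:
  assumes "y \<in> phase_space"
  shows "shift r y \<in> phase_space"
proof (rule phase_space_invariant[OF continuous_on_shift _ assms])
  fix t g assume "g \<in> carrier G"
  moreover have "shift r (point t g) = point (r + t) g"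
    by (rule array_eqI) (simp add: add.assoc)
  ultimately show "shift r (point t g) \<in> phase_space" by (simp add: point_in_phase_space)
qed

lemma continuous_on_act: "continuous_on A (act g)"
proof -
  have "continuous_on A (\<lambda>y. \<pi> i g \<otimes>\<^bsub>F i\<^esub> y (cell k i))" for k i
    by (rule continuous_on_compose2[of UNIV "\<lambda>v. \<pi> i g \<otimes>\<^bsub>F i\<^esub> v"])
      (auto intro: continuous_on_coordinate)
  then show ?thesis unfolding act_def by (rule continuous_on_array)
qed

lemma act_phase_space:
  assumes "g \<in> carrier G" "y \<in> phase_space"
  shows "act g y \<in> phase_space"
proof (rule phase_space_invariant[OF continuous_on_act _ assms(2)])
  fix t h assume "h \<in> carrier G"
  moreover from this have "act g (point t h) = point t (g \<otimes> h)"
    by (intro array_eqI) (simp add: assms(1) m_assoc flip: \<pi>_mult)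
  ultimately show "act g (point t h) \<in> phase_space" using assms(1) by (simp add: point_in_phase_space)
qed

lemma act_one: "y \<in> phase_space \<Longrightarrow> act \<one> y = y"
  by (rule array_eqI) (simp add: \<pi>_one group_F group.is_monoid monoid.l_one phase_space_cell)

lemma act_mult:
  assumes "g \<in> carrier G" "h \<in> carrier G" "y \<in> phase_space"
  shows "act (g \<otimes> h) y = act g (act h y)"
  by (rule array_eqI)
    (simp add: assms \<pi>_mult \<pi>_closed phase_space_cell group_F group.is_monoid monoid.m_assoc)

lemma act_shift: "act g (shift r y) = shift r (act g y)"
  by (rule array_eqI) simp

text \<open>
  The action is free because left multiplication in each \<open>F i\<close> is.
\<close>

lemma act_fixed_point_imp_one:
  assumes "g \<in> carrier G" "y \<in> phase_space" "act g y = y"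
  shows "g = \<one>"
proof (rule separated)
  fix i
  interpret Fi: group "F i" by (rule group_F)
  have "\<pi> i g \<otimes>\<^bsub>F i\<^esub> y (cell 0 i) = y (cell 0 i)"
    using assms(3) by (metis act_cell)
  then show "\<pi> i g = \<pi> i \<one>"
    using assms(1,2) by (simp add: \<pi>_one \<pi>_closed phase_space_cell)
qed (use assms in auto)

text \<open>
  A nontrivial element of the first \<open>N\<close> kernels leaves the first \<open>N\<close> columns of a point
  unchanged but moves the point, since the action is free.
\<close>

lemma phase_space_no_isolated_points:
  assumes y: "y \<in> phase_space"
  shows "\<not> openin (top_of_set phase_space) {y}"
proof
  assume "openin (top_of_set phase_space) {y}"
  then obtain U where "open U" and U: "{y} = phase_space \<inter> U"
    by (auto simp: openin_open)
  then obtain N where N: "\<And>z. agree N z y \<Longrightarrow> z \<in> U"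
    using agree_neighbourhood by (metis Int_iff insertI1)
  obtain g where g: "g \<in> carrier G" "g \<noteq> \<one>" "\<And>i. i < N \<Longrightarrow> \<pi> i g = \<one>\<^bsub>F i\<^esub>"
    using nontrivial_kernel_element[of N] by blast
  have "agree N (act g y) y"
    using g(3) y by (simp add: agree_def group_F group.is_monoid monoid.l_one phase_space_cell)
  then have "act g y = y"
    using N U act_phase_space[OF g(1) y] by blast
  then show False using act_fixed_point_imp_one g y by blast
qed

lemma cantor_space_phase_space: "cantor_space (top_of_set phase_space)"
  unfolding cantor_space_def
proof (intro conjI ballI)
  show "topspace (top_of_set phase_space) \<noteq> {}"
    using point_in_phase_space[OF one_closed] by auto
  show "compact_space (top_of_set phase_space)"
    using compact_phase_space by (simp add: compact_space_subtopology)
  show "metrizable_space (top_of_set phase_space)"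
    by (rule metrizable_space_subtopology[OF metrizable_space_fun_discrete])
next
  fix y assume "y \<in> topspace (top_of_set phase_space)"
  then have y: "y \<in> phase_space" by simp
  show "\<not> openin (top_of_set phase_space) {y}"
    by (rule phase_space_no_isolated_points[OF y])
  have "connectedin (top_of_set phase_space) (connected_component_of_set (top_of_set phase_space) y)"
    by (rule connectedin_connected_component_of)
  then have "connected (connected_component_of_set (top_of_set phase_space) y)"
    by (simp add: connectedin_subtopology)
  moreover have "y \<in> connected_component_of_set (top_of_set phase_space) y"
    using y by (simp add: connected_component_of_refl)
  ultimately show "connected_component_of_set (top_of_set phase_space) y = {y}"
    by (rule connected_fun_discrete_imp_singleton)
qed

text \<open>
  Take a window of \<open>point r h\<close>. A point \<open>y\<close> of the phase space agrees with some
  \<open>point \<tau> g\<close> on any prescribed window, and one that is wider by the gap length \<open>L\<close> suffices: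
  as \<open>L\<close> is independent of \<open>\<tau>\<close> and \<open>g\<close>, it can be fixed before they are chosen, and
  the return to the given window then occurs inside the part where \<open>y\<close> is known.
\<close>

lemma shift_orbit_dense:
  assumes y: "y \<in> phase_space"
  shows "phase_space \<subseteq> closure (range (\<lambda>t. shift t y))"
proof -
  have "point r h \<in> closure (range (\<lambda>t. shift t y))" if h: "h \<in> carrier G" for r h
    unfolding closure_agree
  proof
    fix N
    obtain L where L: "0 \<le> L" "\<And>g p. g \<in> carrier G \<Longrightarrow> \<exists>t. p \<le> t \<and> t \<le> p + L \<and>
      (\<forall>k i. \<bar>k\<bar> \<le> int (N + nat \<bar>r\<bar>) \<longrightarrow> i < N \<longrightarrow> \<pi> i (g \<otimes> word 0 (k + t)) = \<pi> i (word 0 k))"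
      using word_recurrent[of "N + nat \<bar>r\<bar>" N] by blast
    obtain \<tau> g where g: "g \<in> carrier G" and approx: "agree (N + nat L) (point \<tau> g) y"
      using phase_space_approx[OF y] .
    (* Recurrence gives back a window of the base sequence; the factor inv h turns it into one for h. *)
    obtain t where t: "\<tau> - r \<le> t" "t \<le> \<tau> - r + L"
      "\<And>k i. \<bar>k\<bar> \<le> int (N + nat \<bar>r\<bar>) \<Longrightarrow> i < N \<Longrightarrow> \<pi> i (inv h \<otimes> g \<otimes> word 0 (k + t)) = \<pi> i (word 0 k)"
      using L(2)[of "inv h \<otimes> g" "\<tau> - r"] g h by blast
    define s where "s = t + r - \<tau>"
    have s: "0 \<le> s" "s \<le> L" using t by (simp_all add: s_def)
    have "shift s y (cell k i) = point r h (cell k i)" if k: "\<bar>k\<bar> \<le> int N" and i: "i < N" for k i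
    proof -
      have "shift s y (cell k i) = point \<tau> g (cell (k + s) i)"
        using approx k i s by (simp add: agree_def)
      also have "\<dots> = \<pi> i (h \<otimes> (inv h \<otimes> g \<otimes> word 0 ((k + r) + t)))"
        using g h by (simp add: s_def algebra_simps flip: m_assoc)
      also have "\<dots> = \<pi> i (h \<otimes> word 0 (k + r))"
        using t(3)[of "k + r" i] k i g h by (simp add: \<pi>_mult)
      finally show ?thesis by simp
    qed
    then show "\<exists>q\<in>range (\<lambda>t. shift t y). agree N q (point r h)"
      unfolding agree_def by blast
  qed
  then show ?thesis unfolding phase_space_def by (intro closure_minimal) auto
qed

definition shift_action :: "int \<Rightarrow> (nat \<Rightarrow> nat) \<Rightarrow> nat \<Rightarrow> nat"
  where "shift_action n = restrict (shift n) phase_space"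

lemma shift_zero: "shift 0 y = y"
  by (rule array_eqI) simp

lemma shift_add: "shift (m + n) y = shift m (shift n y)"
  by (rule array_eqI) (simp add: algebra_simps)

lemma minimal_cantor_system_phase_space:
  "minimal_cantor_system (top_of_set phase_space) shift_action"
  unfolding minimal_cantor_system_def
proof (intro conjI ballI allI)
  show "cantor_space (top_of_set phase_space)" by (rule cantor_space_phase_space)
  have "shift_action \<in> hom integer_group (BijGroup phase_space)"
    unfolding shift_action_def
    by (rule restrict_action_hom_BijGroup) (auto simp: shift_phase_space shift_zero shift_add)
  then show "group_action integer_group (topspace (top_of_set phase_space)) shift_action"
    by (simp add: group_action_def group_hom_def group_hom_axioms_def group_BijGroup)
  show "homeomorphic_map (top_of_set phase_space) (top_of_set phase_space) (shift_action n)" for n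
    unfolding shift_action_def
    by (rule restrict_action_homeomorphic_map[OF group_integer_group])
      (auto simp: shift_phase_space shift_zero shift_add continuous_on_shift)
  fix y assume "y \<in> topspace (top_of_set phase_space)"
  then have y: "y \<in> phase_space" by simp
  then have orb: "orbit integer_group shift_action y = range (\<lambda>t. shift t y)"
    by (auto simp: orbit_def shift_action_def)
  have "range (\<lambda>t. shift t y) \<subseteq> phase_space" using y shift_phase_space by blast
  then show "top_of_set phase_space closure_of orbit integer_group shift_action y = topspace (top_of_set phase_space)"
    using shift_orbit_dense[OF y] by (auto simp: orb closure_of_subtopology Int_absorb1)
qed

definition act_aut :: "'a \<Rightarrow> (nat \<Rightarrow> nat) \<Rightarrow> nat \<Rightarrow> nat"
  where "act_aut g = restrict (act g) phase_space"

lemma act_aut_hom: "act_aut \<in> hom G (Aut_system (top_of_set phase_space) shift_action)"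
proof -
  have hom: "act_aut \<in> hom G (BijGroup phase_space)"
    unfolding act_aut_def
    by (rule restrict_action_hom_BijGroup) (auto simp: act_phase_space act_one act_mult is_group)
  have "homeomorphic_map (top_of_set phase_space) (top_of_set phase_space) (act_aut g)"
    if "g \<in> carrier G" for g
    unfolding act_aut_def
    by (rule restrict_action_homeomorphic_map[OF is_group])
      (auto simp: that act_phase_space act_one act_mult continuous_on_act)
  moreover have "act_aut g (shift_action n y) = shift_action n (act_aut g y)"
    if "g \<in> carrier G" "y \<in> phase_space" for g n y
    using that by (simp add: act_aut_def shift_action_def act_phase_space shift_phase_space act_shift)
  ultimately show ?thesis
    using hom by (auto simp: hom_def Aut_system_def BijGroup_def)
qed

lemma act_aut_inj: "inj_on act_aut (carrier G)"
proof (rule inj_onI)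
  fix g h assume g: "g \<in> carrier G" and h: "h \<in> carrier G" and eq: "act_aut g = act_aut h"
  define y where "y = point 0 \<one>"
  have y: "y \<in> phase_space" by (simp add: y_def point_in_phase_space)
  have "act g y = act h y" using fun_cong[OF eq, of y] y by (simp add: act_aut_def)
  then have "act (inv h \<otimes> g) y = y"
    using g h y by (metis act_mult act_one inv_closed l_inv)
  then have "inv h \<otimes> g = \<one>" using act_fixed_point_imp_one g h y by blast
  then show "g = h" using g h by (metis inv_closed inv_equality inv_inv)
qed

end

section \<open>Embedding residually finite groups\<close>

lemma infinite_residually_finite_embeds:
  fixes G :: "('a, 'm) monoid_scheme"
  assumes "group G" "countable (carrier G)" "infinite (carrier G)" "residually_finite G"
  obtains X :: "(nat \<Rightarrow> nat) topology" and S f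
  where "minimal_cantor_system X S" "f \<in> hom G (Aut_system X S)" "inj_on f (carrier G)"
proof -
  obtain F :: "nat \<Rightarrow> nat monoid" and \<pi> where F:
    "\<And>i. group (F i)" "\<And>i. finite (carrier (F i))" "\<And>i. \<pi> i \<in> hom G (F i)"
    "\<And>g h. g \<in> carrier G \<Longrightarrow> h \<in> carrier G \<Longrightarrow> (\<And>i. \<pi> i g = \<pi> i h) \<Longrightarrow> g = h"
    using separating_sequence[OF assms(2,3,4)] by blast
  obtain gen :: "nat \<Rightarrow> 'a"
    where gen: "(\<forall>i. gen i \<in> carrier G) \<and> (\<forall>g\<in>carrier G. \<forall>m. \<exists>i\<ge>m. gen i = g)"
    using infinitely_recurring_enumeration[OF assms(2) infinite_imp_nonempty[OF assms(3)]]
    by (rule exE)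
  interpret separated_group G F \<pi> gen
    by (rule separated_group.intro[OF assms(1)], rule separated_group_axioms.intro)
      (fact F assms(3) | use gen in blast)+
  show thesis
    by (rule that[OF minimal_cantor_system_phase_space act_aut_hom act_aut_inj])
qed

theorem proposition11:
  fixes \<Gamma> :: "('g, 'm) monoid_scheme"
  assumes "group \<Gamma>"
    and "countable (carrier \<Gamma>)"
    and "residually_finite \<Gamma>"
  shows "\<exists>(X :: (nat \<Rightarrow> nat) topology) S H.
    minimal_cantor_system X S \<and>
    subgroup H (Aut_system X S) \<and>
    \<Gamma> \<cong> (Aut_system X S)\<lparr>carrier := H\<rparr>"
proof -
  interpret group \<Gamma> by fact
  (* The factor integer_group makes the group infinite, on which the absence of isolated points rests. *)
  let ?P = "\<Gamma> \<times>\<times> integer_group"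
  have "infinite (carrier ?P)"
    using one_closed by (auto simp: finite_cartesian_product_iff)
  moreover have "group ?P" "countable (carrier ?P)" "residually_finite ?P"
    using assms by (simp_all add: DirProd_group residually_finite_DirProd residually_finite_integer_group)
  ultimately obtain X :: "(nat \<Rightarrow> nat) topology" and S f
    where XS: "minimal_cantor_system X S" and f: "f \<in> hom ?P (Aut_system X S)" "inj_on f (carrier ?P)"
    using infinite_residually_finite_embeds by metis
  define h where "h g = f (g, 0)" for g
  have S: "group_action integer_group (topspace X) S"
    using XS by (simp add: minimal_cantor_system_def)
  have "S n ` topspace X \<subseteq> topspace X" for n
    using group_action.surj_prop[OF S, of n] by simp
  then have Aut: "group (Aut_system X S)" by (rule group_Aut_system)
  have "h \<in> hom \<Gamma> (Aut_system X S)"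
  proof (rule homI)
    fix x y assume "x \<in> carrier \<Gamma>" "y \<in> carrier \<Gamma>"
    then show "h (x \<otimes>\<^bsub>\<Gamma>\<^esub> y) = h x \<otimes>\<^bsub>Aut_system X S\<^esub> h y"
      using hom_mult[OF f(1), of "(x, 0)" "(y, 0)"] by (simp add: h_def)
  qed (use f(1) in \<open>auto simp: h_def hom_def\<close>)
  with Aut have hom: "group_hom \<Gamma> (Aut_system X S) h"
    by (simp add: group_hom_def group_hom_axioms_def is_group)
  have "inj_on h (carrier \<Gamma>)"
    using f(2) by (auto simp: h_def inj_on_def)
  then have "h \<in> iso \<Gamma> ((Aut_system X S)\<lparr>carrier := h ` carrier \<Gamma>\<rparr>)"
    using group_hom.homh[OF hom] by (auto simp: iso_def hom_def bij_betw_def)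
  then show ?thesis
    using XS group_hom.img_is_subgroup[OF hom] is_isoI by blast
qed

end
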